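(* Let $a<b$ be real numbers, let $f:[a,b]\to (0,\infty)$ be log-convex and let $N\in\mathbb{N}$. If $0\leq \nu\leq \frac{1}{2}$, then $$f\left((1-\nu)a+\nu b\right)\left(\frac{f(a)f(b)}{f^2(\frac{a+b}{2})}\right)^{1-A_1(\nu)}\geq f^{1-\nu}(a)f^{\nu}(b)\prod_{j=1}^{N}\left(\frac{f(t_j)f(u_j)}{f^2(w_j)}\right)^{A_j(1-2\nu)},$$ where $t_j=x_j\left(1-2\nu;\frac{a+b}{2},b\right)$, $u_j=y_j\left(1-2\nu;\frac{a+b}{2},b\right)$, $w_j=z_j\left(1-2\nu;\frac{a+b}{2},b\right)$. If $\frac{1}{2}\leq\nu\leq 1$, then $$f\left((1-\nu)a+\nu b\right)\left(\frac{f(a)f(b)}{f^2(\frac{a+b}{2})}\right)^{1-A_1(\nu)}\geq f^{1-\nu}(a)f^{\nu}(b)\prod_{j=1}^{N}\left(\frac{f(t_j)f(u_j)}{f^2(w_j)}\right)^{A_j(2-2\nu)},$$ where $t_j=x_j\left(2-2\nu;a,\frac{a+b}{2}\right)$, $u_j=y_j\left(2-2\nu;a,\frac{a+b}{2}\right)$, $w_j=z_j\left(2-2\nu;a,\frac{a+b}{2}\right)$.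
   Context: $\mathbb{N}=\{1,2,3,\dots\}$ and $[\cdot]$ denotes the integer part (floor). A function $f$ with values in $(0,\infty)$ is log-convex if $\log f$ is convex. For $0\le\mu\le 1$ and $j\in\mathbb{N}$ let $k_j(\mu)=[2^{j-1}\mu]$, $r_j(\mu)=[2^{j}\mu]$, $$A_j(\mu)=(-1)^{r_j(\mu)}2^{j-1}\mu+(-1)^{r_j(\mu)+1}\left[\frac{r_j(\mu)+1}{2}\right],$$ and for reals $c<d$ let $$x_j(\mu;c,d)=\left(1-\tfrac{k_j(\mu)}{2^{j-1}}\right)c+\tfrac{k_j(\mu)}{2^{j-1}}d,\quad y_j(\mu;c,d)=\left(1-\tfrac{k_j(\mu)+1}{2^{j-1}}\right)c+\tfrac{k_j(\mu)+1}{2^{j-1}}d,$$ $$z_j(\mu;c,d)=\left(1-\tfrac{2k_j(\mu)+1}{2^{j}}\right)c+\tfrac{2k_j(\mu)+1}{2^{j}}d.$$ When $\mu=1$ the points $y_j,z_j$ lie outside $[c,d]$, but then $A_j(\mu)=0$ and the corresponding factor is read as $1$. *)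

theory Defs
  imports "HOL-Analysis.Convex"
begin

definition log_convex_on :: "real set \<Rightarrow> (real \<Rightarrow> real) \<Rightarrow> bool" where
  "log_convex_on S f \<longleftrightarrow> (\<forall>x\<in>S. 0 < f x) \<and> convex_on S (\<lambda>x. ln (f x))"

text \<open>
  In all definitions below the index \<open>j\<close> is meant to be at least 1 (so that
  \<open>j - 1\<close> is not truncated) and \<open>\<mu>\<close> to lie in \<open>[0,1]\<close>.
\<close>

definition k_idx :: "nat \<Rightarrow> real \<Rightarrow> int" where
  "k_idx j \<mu> = \<lfloor>2 ^ (j - 1) * \<mu>\<rfloor>"

definition r_idx :: "nat \<Rightarrow> real \<Rightarrow> int" where
  "r_idx j \<mu> = \<lfloor>2 ^ j * \<mu>\<rfloor>"

definition A_coef :: "nat \<Rightarrow> real \<Rightarrow> real" where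
  "A_coef j \<mu> = (-1) powi (r_idx j \<mu>) * 2 ^ (j - 1) * \<mu>
     + (-1) powi (r_idx j \<mu> + 1) * of_int \<lfloor>(of_int (r_idx j \<mu>) + 1) / 2 :: real\<rfloor>"

definition x_pt :: "nat \<Rightarrow> real \<Rightarrow> real \<Rightarrow> real \<Rightarrow> real" where
  "x_pt j \<mu> c d = (1 - of_int (k_idx j \<mu>) / 2 ^ (j - 1)) * c
     + of_int (k_idx j \<mu>) / 2 ^ (j - 1) * d"

definition y_pt :: "nat \<Rightarrow> real \<Rightarrow> real \<Rightarrow> real \<Rightarrow> real" where
  "y_pt j \<mu> c d = (1 - (of_int (k_idx j \<mu>) + 1) / 2 ^ (j - 1)) * c
     + (of_int (k_idx j \<mu>) + 1) / 2 ^ (j - 1) * d"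

definition z_pt :: "nat \<Rightarrow> real \<Rightarrow> real \<Rightarrow> real \<Rightarrow> real" where
  "z_pt j \<mu> c d = (1 - (2 * of_int (k_idx j \<mu>) + 1) / 2 ^ j) * c
     + (2 * of_int (k_idx j \<mu>) + 1) / 2 ^ j * d"

text \<open>
  For \<open>\<mu> = 1\<close> the points \<open>y_pt\<close> and \<open>z_pt\<close> lie outside \<open>[c,d]\<close>, where \<open>f\<close> need not
  be meaningful; there \<open>A_coef j \<mu> = 0\<close> and the factor is 1 by convention. The
  explicit case is needed because \<open>f\<close> may vanish there and \<open>0 powr 0 = 0\<close>.
\<close>

definition refinement_factor ::
  "(real \<Rightarrow> real) \<Rightarrow> real \<Rightarrow> real \<Rightarrow> real \<Rightarrow> nat \<Rightarrow> real" where
  "refinement_factor f c d \<mu> j =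
     (if \<mu> = 1 then 1
      else (f (x_pt j \<mu> c d) * f (y_pt j \<mu> c d) / (f (z_pt j \<mu> c d))\<^sup>2) powr A_coef j \<mu>)"

end

theory Submission
  imports Defs
begin

text \<open>
  Put \<open>g = ln f\<close>. The weight \<open>A_coef j \<mu>\<close> is the distance from \<open>2 ^ (j - 1) * \<mu>\<close> to the nearest
  integer, and \<open>A_coef j \<mu> * (g x\<^sub>j + g y\<^sub>j - 2 * g z\<^sub>j)\<close> is the drop at \<open>\<mu>\<close> between the piecewise
  linear interpolants of \<open>g\<close> on the dyadic grids of levels \<open>j - 1\<close> and \<open>j\<close>. The sum over \<open>j\<close>
  telescopes, and since every interpolant lies above the convex \<open>g\<close>, it is at most
  \<open>(1 - \<mu>) * g c + \<mu> * g d - g ((1 - \<mu>) * c + \<mu> * d)\<close>. For both halves of \<open>[a,b]\<close> the latter point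
  is the reflection \<open>\<nu> * a + (1 - \<nu>) * b\<close> of \<open>(1 - \<nu>) * a + \<nu> * b\<close> in the midpoint, so what
  remains is midpoint convexity for these two points.
\<close>

text \<open>Doubling appends the next binary digit of \<mu>: it is 0 or 1 according to which half of
  its dyadic cell of level \<open>j\<close> contains \<mu>.\<close>

lemma r_idx_cases:
  "r_idx (Suc j) \<mu> = 2 * k_idx (Suc j) \<mu> \<and> 2 ^ j * \<mu> - of_int (k_idx (Suc j) \<mu>) < 1 / 2 \<or>
   r_idx (Suc j) \<mu> = 2 * k_idx (Suc j) \<mu> + 1 \<and> 2 ^ j * \<mu> - of_int (k_idx (Suc j) \<mu>) \<ge> 1 / 2"
proof -
  define w where "w = 2 ^ j * \<mu>"
  have "r_idx (Suc j) \<mu> = \<lfloor>2 * w\<rfloor>" "k_idx (Suc j) \<mu> = \<lfloor>w\<rfloor>"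
    by (simp_all add: w_def r_idx_def k_idx_def mult.assoc)
  then show ?thesis
    unfolding w_def[symmetric] by linarith
qed

lemma A_coef_even:
  assumes "r_idx (Suc j) \<mu> = 2 * k"
  shows "A_coef (Suc j) \<mu> = 2 ^ j * \<mu> - of_int k"
proof -
  have "\<lfloor>(2 * of_int k + 1) / 2 :: real\<rfloor> = k" by (simp add: floor_eq_iff)
  then show ?thesis
    by (simp add: A_coef_def assms power_int_add power_int_mult)
qed

lemma A_coef_odd:
  assumes "r_idx (Suc j) \<mu> = 2 * k + 1"
  shows "A_coef (Suc j) \<mu> = 1 - (2 ^ j * \<mu> - of_int k)"
proof -
  have "\<lfloor>(2 * of_int k + 1 + 1) / 2 :: real\<rfloor> = k + 1" by (simp add: floor_eq_iff)
  then show ?thesis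
    by (simp add: A_coef_def assms power_int_add power_int_mult)
qed

text \<open>The value at \<open>(1 - \<mu>) * c + \<mu> * d\<close> of the piecewise linear
  interpolant of \<open>g\<close> on the grid of \<open>2 ^ j\<close> equal cells. The indices are
  \<open>Suc j\<close> because \<open>k_idx\<close> scales by the exponent one below its
  index.\<close>

definition dyadic_interp :: "(real \<Rightarrow> real) \<Rightarrow> real \<Rightarrow> real \<Rightarrow> real \<Rightarrow> nat \<Rightarrow> real" where
  "dyadic_interp g c d \<mu> j =
     (1 - (2 ^ j * \<mu> - of_int (k_idx (Suc j) \<mu>))) * g (x_pt (Suc j) \<mu> c d)
     + (2 ^ j * \<mu> - of_int (k_idx (Suc j) \<mu>)) * g (y_pt (Suc j) \<mu> c d)"

text \<open>Halving the cell keeps one endpoint and replaces the other by the midpoint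
  \<open>z_pt\<close>. If \<mu> lies at relative distance \<open>t\<close> from the kept endpoint,
  the weights \<open>1 - t, t\<close> become \<open>1 - 2 * t, 2 * t\<close>, so the drop is
  \<open>t\<close> times the second difference; \<open>t\<close> is \<open>A_coef\<close>. This is
  pure algebra, valid for every \<open>g\<close>.\<close>

lemma dyadic_interp_step:
  "dyadic_interp g c d \<mu> j - dyadic_interp g c d \<mu> (Suc j) =
     A_coef (Suc j) \<mu> * (g (x_pt (Suc j) \<mu> c d) + g (y_pt (Suc j) \<mu> c d)
       - 2 * g (z_pt (Suc j) \<mu> c d))"
proof -
  define k where "k = k_idx (Suc j) \<mu>"
  have k': "k_idx (Suc (Suc j)) \<mu> = r_idx (Suc j) \<mu>"
    by (simp add: k_idx_def r_idx_def)
  have "r_idx (Suc j) \<mu> = 2 * k \<or> r_idx (Suc j) \<mu> = 2 * k + 1"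
    using r_idx_cases[of j \<mu>] unfolding k_def by blast
  then show ?thesis
  proof
    assume r: "r_idx (Suc j) \<mu> = 2 * k"
    have "x_pt (Suc (Suc j)) \<mu> c d = x_pt (Suc j) \<mu> c d"
         "y_pt (Suc (Suc j)) \<mu> c d = z_pt (Suc j) \<mu> c d"
      by (simp_all add: x_pt_def y_pt_def z_pt_def k' r flip: k_def)
    then show ?thesis
      by (simp add: dyadic_interp_def k' A_coef_even[OF r] r flip: k_def) (simp add: algebra_simps)
  next
    assume r: "r_idx (Suc j) \<mu> = 2 * k + 1"
    \<comment> \<open>In the right half the new right endpoint has index \<open>2 * k + 2\<close> on
      the finer grid, which is the old right endpoint.\<close>
    have "(2 * real_of_int k + 2) / (2 * 2 ^ j) = (real_of_int k + 1) / 2 ^ j"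
      by (simp add: field_simps)
    then have "x_pt (Suc (Suc j)) \<mu> c d = z_pt (Suc j) \<mu> c d"
         "y_pt (Suc (Suc j)) \<mu> c d = y_pt (Suc j) \<mu> c d"
      by (simp_all add: x_pt_def y_pt_def z_pt_def k' r add.commute flip: k_def)
    then show ?thesis
      by (simp add: dyadic_interp_def k' A_coef_odd[OF r] r flip: k_def) (simp add: algebra_simps)
  qed
qed

lemma dyadic_interp_0:
  assumes "0 \<le> \<mu>" "\<mu> < 1"
  shows "dyadic_interp g c d \<mu> 0 = (1 - \<mu>) * g c + \<mu> * g d"
proof -
  have "k_idx (Suc 0) \<mu> = 0" using assms by (simp add: k_idx_def floor_eq_iff)
  then show ?thesis by (simp add: dyadic_interp_def x_pt_def y_pt_def)
qed

lemma affine_comb_in_interval: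
  fixes c d s :: real
  assumes "c \<le> d" "0 \<le> s" "s \<le> 1"
  shows "(1 - s) * c + s * d \<in> {c..d}"
proof -
  have "0 \<le> s * (d - c)" "0 \<le> (1 - s) * (d - c)" using assms by simp_all
  then show ?thesis by (simp add: algebra_simps)
qed

lemma dyadic_points_in_interval:
  assumes "0 \<le> \<mu>" "\<mu> < 1" "c \<le> d"
  shows "x_pt (Suc j) \<mu> c d \<in> {c..d}" "y_pt (Suc j) \<mu> c d \<in> {c..d}"
    "z_pt (Suc j) \<mu> c d \<in> {c..d}"
proof -
  define K where "K = real_of_int (k_idx (Suc j) \<mu>)"
  have "0 \<le> K" using assms by (simp add: K_def k_idx_def)
  have "2 ^ j * \<mu> < 2 ^ j" using assms by simp
  \<comment> \<open>Integrality sharpens the strict bound to leave room for a whole cell; this fails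
    at \<open>\<mu> = 1\<close>.\<close>
  then have "k_idx (Suc j) \<mu> + 1 \<le> 2 ^ j"
    by (simp add: k_idx_def add1_zle_eq floor_less_iff)
  then have "real_of_int (k_idx (Suc j) \<mu> + 1) \<le> real_of_int (2 ^ j)"
    by (simp only: of_int_le_iff)
  then have "K + 1 \<le> 2 ^ j" by (simp add: K_def)
  with \<open>0 \<le> K\<close> show "x_pt (Suc j) \<mu> c d \<in> {c..d}" "y_pt (Suc j) \<mu> c d \<in> {c..d}"
    "z_pt (Suc j) \<mu> c d \<in> {c..d}"
    unfolding x_pt_def y_pt_def z_pt_def K_def[symmetric] using \<open>c \<le> d\<close>
    by - (rule affine_comb_in_interval; simp add: divide_le_eq)+
qed

text \<open>The point is the convex combination of the endpoints of its cell whose weight is the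
  fractional part \<open>t\<close> of \<open>2 ^ j * \<mu>\<close>, so convexity applies
  directly.\<close>

lemma dyadic_interp_ge:
  assumes "convex_on {c..d} g" "0 \<le> \<mu>" "\<mu> < 1" "c \<le> d"
  shows "g ((1 - \<mu>) * c + \<mu> * d) \<le> dyadic_interp g c d \<mu> j"
proof -
  define k where "k = k_idx (Suc j) \<mu>"
  define t where "t = 2 ^ j * \<mu> - of_int k"
  have t: "0 \<le> t" "t \<le> 1"
    unfolding t_def k_def k_idx_def by (simp, simp, linarith)
  have \<mu>: "\<mu> = (t + k) / 2 ^ j" by (simp add: t_def)
  have "(1 - \<mu>) * c + \<mu> * d = (1 - t) * x_pt (Suc j) \<mu> c d + t * y_pt (Suc j) \<mu> c d"
    unfolding x_pt_def y_pt_def k_def[symmetric] diff_Suc_1 unfolding \<mu>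
    by (simp add: field_simps)
  then show ?thesis
    using convex_onD[OF assms(1) t dyadic_points_in_interval(1,2)[OF assms(2-4)], of j j]
    by (simp add: dyadic_interp_def flip: k_def t_def)
qed

lemma convex_dyadic_refinement:
  assumes "convex_on {c..d} g" "0 \<le> \<mu>" "\<mu> < 1" "c \<le> d"
  shows "g ((1 - \<mu>) * c + \<mu> * d)
     + (\<Sum>j=1..N. A_coef j \<mu> * (g (x_pt j \<mu> c d) + g (y_pt j \<mu> c d) - 2 * g (z_pt j \<mu> c d)))
     \<le> (1 - \<mu>) * g c + \<mu> * g d"
proof -
  have "(\<Sum>j=1..N. A_coef j \<mu> * (g (x_pt j \<mu> c d) + g (y_pt j \<mu> c d) - 2 * g (z_pt j \<mu> c d)))
      = (\<Sum>j<N. dyadic_interp g c d \<mu> j - dyadic_interp g c d \<mu> (Suc j))"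
    unfolding dyadic_interp_step by (simp add: sum.atLeast1_atMost_eq)
  also have "\<dots> = (1 - \<mu>) * g c + \<mu> * g d - dyadic_interp g c d \<mu> N"
    using assms by (simp add: sum_lessThan_telescope' dyadic_interp_0)
  finally show ?thesis using dyadic_interp_ge[OF assms, of N] by simp
qed

lemma prod_refinement_factor_le:
  assumes f: "log_convex_on {c..d} f" and \<mu>: "0 \<le> \<mu>" "\<mu> \<le> 1" and "c \<le> d"
  shows "(\<Prod>j=1..N. refinement_factor f c d \<mu> j)
    \<le> exp ((1 - \<mu>) * ln (f c) + \<mu> * ln (f d) - ln (f ((1 - \<mu>) * c + \<mu> * d)))"
proof (cases "\<mu> = 1")
  case True
  \<comment> \<open>Every factor is 1 by convention, and the exponent on the right vanishes.\<close>
  then show ?thesis by (simp add: refinement_factor_def)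
next
  case False
  with \<mu> have "\<mu> < 1" by simp
  define g where "g = (\<lambda>x. ln (f x))"
  have "refinement_factor f c d \<mu> j =
      exp (A_coef j \<mu> * (g (x_pt j \<mu> c d) + g (y_pt j \<mu> c d) - 2 * g (z_pt j \<mu> c d)))"
    if j: "j \<in> {1..N}" for j
  proof -
    obtain i where "j = Suc i" using j by (cases j) simp_all
    then have "f (x_pt j \<mu> c d) > 0" "f (y_pt j \<mu> c d) > 0" "f (z_pt j \<mu> c d) > 0"
      using f dyadic_points_in_interval[OF \<mu>(1) \<open>\<mu> < 1\<close> \<open>c \<le> d\<close>, of i]
      by (simp_all add: log_convex_on_def)
    then show ?thesis
      using False by (simp add: refinement_factor_def powr_def g_def ln_mult ln_div ln_realpow)
  qed
  then have "(\<Prod>j=1..N. refinement_factor f c d \<mu> j) =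
      exp (\<Sum>j=1..N. A_coef j \<mu> * (g (x_pt j \<mu> c d) + g (y_pt j \<mu> c d) - 2 * g (z_pt j \<mu> c d)))"
    by (simp add: exp_sum)
  moreover have "convex_on {c..d} g" using f by (simp add: log_convex_on_def g_def)
  ultimately show ?thesis
    using convex_dyadic_refinement[of c d g \<mu> N] \<mu> \<open>\<mu> < 1\<close> \<open>c \<le> d\<close>
    by (simp add: g_def)
qed

text \<open>Turns the exponent \<open>1 - A_coef 1 \<nu>\<close> into \<open>1 - \<nu>\<close> on
  the first half and \<nu> on the second. The value \<open>\<nu> = 1\<close> is separate because
  \<open>k_idx\<close> is 1 there, not 0.\<close>

lemma A_coef_1:
  assumes "0 \<le> \<nu>" "\<nu> \<le> 1"
  shows "A_coef 1 \<nu> = min \<nu> (1 - \<nu>)"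
proof (cases "\<nu> = 1")
  case True
  then show ?thesis by (simp add: A_coef_def r_idx_def)
next
  case False
  then have "k_idx (Suc 0) \<nu> = 0" using assms by (simp add: k_idx_def floor_eq_iff)
  then show ?thesis
    using r_idx_cases[of 0 \<nu>] A_coef_even[of 0 \<nu> 0] A_coef_odd[of 0 \<nu> 0] by auto
qed

lemma log_convex_on_subset:
  assumes "log_convex_on S f" "T \<subseteq> S" "convex T"
  shows "log_convex_on T f"
  using assms by (auto simp: log_convex_on_def intro: convex_on_subset)

lemma midpoint_le_reflected_pair:
  fixes a b \<nu> :: real
  assumes "convex_on {a..b} g" "a \<le> b" "0 \<le> \<nu>" "\<nu> \<le> 1"
  shows "2 * g ((a + b) / 2) \<le> g ((1 - \<nu>) * a + \<nu> * b) + g (\<nu> * a + (1 - \<nu>) * b)"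
proof -
  have mem: "(1 - \<nu>) * a + \<nu> * b \<in> {a..b}" "\<nu> * a + (1 - \<nu>) * b \<in> {a..b}"
    using affine_comb_in_interval[of a b \<nu>] affine_comb_in_interval[of a b "1 - \<nu>"] assms
    by simp_all
  have mid: "(1 - 1/2) * ((1 - \<nu>) * a + \<nu> * b) + 1/2 * (\<nu> * a + (1 - \<nu>) * b) = (a + b) / 2"
    by (simp add: field_simps)
  show ?thesis
    using convex_onD[OF assms(1) _ _ mem, of "1/2"] unfolding real_scaleR_def mid by simp
qed

theorem corollary2p12:
  fixes f :: "real \<Rightarrow> real" and a b \<nu> :: real and N :: nat
  assumes "a < b"
    and "log_convex_on {a..b} f"
    and "N \<ge> 1"
  shows "(0 \<le> \<nu> \<and> \<nu> \<le> 1 / 2 \<longrightarrow>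
           f ((1 - \<nu>) * a + \<nu> * b) * (f a * f b / (f ((a + b) / 2))\<^sup>2) powr (1 - A_coef 1 \<nu>)
             \<ge> f a powr (1 - \<nu>) * f b powr \<nu>
                * (\<Prod>j=1..N. refinement_factor f ((a + b) / 2) b (1 - 2 * \<nu>) j))
       \<and> (1 / 2 \<le> \<nu> \<and> \<nu> \<le> 1 \<longrightarrow>
           f ((1 - \<nu>) * a + \<nu> * b) * (f a * f b / (f ((a + b) / 2))\<^sup>2) powr (1 - A_coef 1 \<nu>)
             \<ge> f a powr (1 - \<nu>) * f b powr \<nu>
                * (\<Prod>j=1..N. refinement_factor f a ((a + b) / 2) (2 - 2 * \<nu>) j))"
proof -
  define g where "g = (\<lambda>x. ln (f x))"
  define m where "m = (a + b) / 2"
  define p where "p = (1 - \<nu>) * a + \<nu> * b"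
  define q where "q = \<nu> * a + (1 - \<nu>) * b"
  have m: "a \<le> m" "m \<le> b" using assms(1) by (simp_all add: m_def)
  have pos: "f x > 0" if "x \<in> {a..b}" for x
    using assms(2) that by (simp add: log_convex_on_def)
  have f_pos: "f a > 0" "f b > 0" "f m > 0" using m by (auto intro: pos)
  \<comment> \<open>Shared by both halves: \<open>P\<close> will be the product and \<open>s\<close>
    the logarithm of its upper bound, which leaves an inequality linear in the values of
    \<open>g\<close>.\<close>
  have log_form: "f a powr (1 - \<nu>) * f b powr \<nu> * P
      \<le> f p * (f a * f b / (f m)\<^sup>2) powr (1 - A_coef 1 \<nu>)"
    if "0 \<le> \<nu>" "\<nu> \<le> 1" and P: "P \<le> exp s"
      and s: "(1 - \<nu>) * g a + \<nu> * g b + s \<le> g p + (1 - A_coef 1 \<nu>) * (g a + g b - 2 * g m)"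
    for P s
  proof -
    have "p \<in> {a..b}"
      unfolding p_def using assms(1) that by (intro affine_comb_in_interval) auto
    then have "f p > 0" by (rule pos)
    have "f a powr (1 - \<nu>) * f b powr \<nu> * P \<le> f a powr (1 - \<nu>) * f b powr \<nu> * exp s"
      using P by (intro mult_left_mono) simp_all
    also have "\<dots> = exp ((1 - \<nu>) * g a + \<nu> * g b + s)"
      using f_pos by (simp add: powr_def g_def exp_add)
    also have "\<dots> \<le> exp (g p + (1 - A_coef 1 \<nu>) * (g a + g b - 2 * g m))"
      using s by simp
    also have "\<dots> = f p * (f a * f b / (f m)\<^sup>2) powr (1 - A_coef 1 \<nu>)"
      using f_pos \<open>f p > 0\<close>
      by (simp add: powr_def g_def exp_add ln_mult ln_div ln_realpow)
    finally show ?thesis .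
  qed
  have mid: "2 * g m \<le> g p + g q" if "0 \<le> \<nu>" "\<nu> \<le> 1"
    using midpoint_le_reflected_pair[of a b g \<nu>] assms that
    by (simp add: log_convex_on_def g_def m_def p_def q_def)
  show ?thesis
    unfolding m_def[symmetric] p_def[symmetric]
  proof (intro conjI impI; elim conjE)
    assume \<nu>: "0 \<le> \<nu>" "\<nu> \<le> 1 / 2"
    have q: "(1 - (1 - 2 * \<nu>)) * m + (1 - 2 * \<nu>) * b = q"
      by (simp add: m_def q_def field_simps)
    have "log_convex_on {m..b} f"
      using assms(2) m by (auto intro: log_convex_on_subset)
    then have P: "(\<Prod>j=1..N. refinement_factor f m b (1 - 2 * \<nu>) j)
        \<le> exp (2 * \<nu> * g m + (1 - 2 * \<nu>) * g b - g q)"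
      using prod_refinement_factor_le[of m b f "1 - 2 * \<nu>" N] \<nu> m by (simp add: g_def q[simplified])
    have A: "A_coef 1 \<nu> = \<nu>" using A_coef_1[of \<nu>] \<nu> by simp
    \<comment> \<open>In logarithms both sides carry \<open>(1 - \<nu>) * (g a + g b)\<close>, and
      the terms in \<open>g m\<close> add up to \<open>2 * g m\<close>; what remains is exactly
      \<open>mid\<close>.\<close>
    show "f a powr (1 - \<nu>) * f b powr \<nu> * (\<Prod>j=1..N. refinement_factor f m b (1 - 2 * \<nu>) j)
      \<le> f p * (f a * f b / (f m)\<^sup>2) powr (1 - A_coef 1 \<nu>)"
      using \<nu> mid by (intro log_form[OF _ _ P]) (auto simp: A[simplified] algebra_simps)
  next
    assume \<nu>: "1 / 2 \<le> \<nu>" "\<nu> \<le> 1"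
    have q: "(1 - (2 - 2 * \<nu>)) * a + (2 - 2 * \<nu>) * m = q"
      by (simp add: m_def q_def field_simps)
    have "log_convex_on {a..m} f"
      using assms(2) m by (auto intro: log_convex_on_subset)
    then have P: "(\<Prod>j=1..N. refinement_factor f a m (2 - 2 * \<nu>) j)
        \<le> exp ((2 * \<nu> - 1) * g a + (2 - 2 * \<nu>) * g m - g q)"
      using prod_refinement_factor_le[of a m f "2 - 2 * \<nu>" N] \<nu> m by (simp add: g_def q[simplified])
    have A: "A_coef 1 \<nu> = 1 - \<nu>" using A_coef_1[of \<nu>] \<nu> by simp
    \<comment> \<open>The same cancellation, now with \<open>\<nu> * (g a + g b)\<close> on both
      sides.\<close>
    show "f a powr (1 - \<nu>) * f b powr \<nu> * (\<Prod>j=1..N. refinement_factor f a m (2 - 2 * \<nu>) j)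
      \<le> f p * (f a * f b / (f m)\<^sup>2) powr (1 - A_coef 1 \<nu>)"
      using \<nu> mid by (intro log_form[OF _ _ P]) (auto simp: A[simplified] algebra_simps)
  qed
qed

end
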